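(* Let $N\in\mathbb N$ and let $\hat\rho_0\in\mathrm{Herm}(N)$ be positive semidefinite of full rank. For every Hermitian matrix $\hat\sigma\in\mathrm{Herm}(N)$, the conjugate functional of $\widehat{\mathrm{QKL}}(\cdot,\hat\rho_0)$ is given by $$\big(\widehat{\mathrm{QKL}}(\cdot,\hat\rho_0)\big)^*(\hat\sigma)=\operatorname{tr}\big(\exp(\hat\sigma+\ln\hat\rho_0)-\hat\rho_0\big).$$
   Context: $\mathrm{Herm}(N)$ is the real vector space of Hermitian $N\times N$ complex matrices with inner product $\langle\hat\sigma,\hat\rho\rangle=\operatorname{tr}(\hat\sigma\hat\rho)$. The quantum relative entropy $\widehat{\mathrm{QKL}}(\hat\rho,\hat\rho_0)$ (with $\hat\rho_0$ positive definite) equals $\operatorname{tr}(\hat\rho_0-\hat\rho+\hat\rho\ln\hat\rho-\hat\rho\ln\hat\rho_0)$ if $\hat\rho$ is positive semidefinite (with $0\ln0=0$ in the spectral calculus), and $+\infty$ otherwise. The conjugate of $F:\mathrm{Herm}(N)\to\mathbb R\cup\{\infty\}$ is $F^*(\hat\sigma)=\sup_{\hat\rho\in\mathrm{Herm}(N)}\big(\operatorname{tr}(\hat\sigma\hat\rho)-F(\hat\rho)\big)$. *)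

theory Defs
  imports
    "HOL-Library.Extended_Real"
    "Jordan_Normal_Form.Schur_Decomposition"
    "Jordan_Normal_Form.DL_Rank"
begin

definition Herm :: "nat \<Rightarrow> complex mat set" where
  "Herm N = {A \<in> carrier_mat N N. mat_adjoint A = A}"

definition mtrace :: "complex mat \<Rightarrow> complex" where
  "mtrace A = (\<Sum>i<dim_row A. A $$ (i, i))"

definition pos_semidef :: "complex mat \<Rightarrow> bool" where
  "pos_semidef A \<longleftrightarrow> A \<in> Herm (dim_row A) \<and>
     (\<forall>v \<in> carrier_vec (dim_row A). 0 \<le> Re ((A *\<^sub>v v) \<bullet>c v))"

definition unitary_mat :: "complex mat \<Rightarrow> bool" where
  "unitary_mat U \<longleftrightarrow> U \<in> carrier_mat (dim_row U) (dim_row U) \<and>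
     mat_adjoint U * U = 1\<^sub>m (dim_row U)"

definition real_diag :: "nat \<Rightarrow> (nat \<Rightarrow> real) \<Rightarrow> complex mat" where
  "real_diag N d = mat_diag N (\<lambda>i. complex_of_real (d i))"

(* Spectral calculus. For Hermitian A a unitary diagonalisation exists, and the value
   U f(d) U^* does not depend on the one chosen; for other A the value is unspecified. *)
definition spectral_fun :: "(real \<Rightarrow> real) \<Rightarrow> complex mat \<Rightarrow> complex mat" where
  "spectral_fun f A = (THE B. \<exists>U d. U \<in> carrier_mat (dim_row A) (dim_row A) \<and> unitary_mat U \<and>
      A = U * real_diag (dim_row A) d * mat_adjoint U \<and>
      B = U * real_diag (dim_row A) (\<lambda>i. f (d i)) * mat_adjoint U)"

definition mat_ln :: "complex mat \<Rightarrow> complex mat" where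
  "mat_ln A = spectral_fun ln A"

definition mat_xlnx :: "complex mat \<Rightarrow> complex mat" where
  "mat_xlnx A = spectral_fun (\<lambda>x. if x = 0 then 0 else x * ln x) A"

(* The exponential series converges absolutely in every entry. *)
definition mat_exp :: "complex mat \<Rightarrow> complex mat" where
  "mat_exp A = mat (dim_row A) (dim_row A) (\<lambda>(i, j). \<Sum>k. (A ^\<^sub>m k) $$ (i, j) / fact k)"

(* Every trace below is real (all matrices involved are Hermitian or products of two
   Hermitian matrices), so Re only changes the type. *)
definition QKL :: "complex mat \<Rightarrow> complex mat \<Rightarrow> ereal" where
  "QKL \<rho> \<rho>0 = (if pos_semidef \<rho>
     then ereal (Re (mtrace (\<rho>0 - \<rho> + mat_xlnx \<rho> - \<rho> * mat_ln \<rho>0)))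
     else \<infinity>)"

definition herm_conjugate :: "nat \<Rightarrow> (complex mat \<Rightarrow> ereal) \<Rightarrow> complex mat \<Rightarrow> ereal" where
  "herm_conjugate N F \<sigma> = (SUP \<rho> \<in> Herm N. ereal (Re (mtrace (\<sigma> * \<rho>))) - F \<rho>)"

end

theory Submission
  imports Defs
begin

text \<open>
  Put \<open>H = \<sigma> + ln \<rho>0\<close>; the conjugate is the supremum of
  \<open>tr (H \<rho>) + tr \<rho> - tr (\<rho> ln \<rho>) - tr \<rho>0\<close> over positive semidefinite \<open>\<rho>\<close>.
  If \<open>H\<close> and \<open>\<rho>\<close> are diagonalised by unitaries \<open>V\<close> and \<open>U\<close> with eigenvalues \<open>h i\<close> and \<open>p j\<close>,
  the numbers \<open>\<bar>(V\<^sup>* U) i j\<bar>\<^sup>2\<close> form a doubly stochastic matrix, and averaging the scalar Young inequality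
  \<open>h p + p - p ln p \<le> exp h\<close> with these weights bounds the first three terms by \<open>tr (exp H)\<close>.
  Equality holds for \<open>\<rho> = exp H\<close>.
\<close>

section \<open>Unitary diagonalisation of Hermitian matrices\<close>

lemma dim_mat_adjoint [simp]:
  "dim_row (mat_adjoint A) = dim_col A" "dim_col (mat_adjoint A) = dim_row A"
  by (simp_all add: mat_adjoint_def)

lemma mat_adjoint_carrier [simp]: "A \<in> carrier_mat n m \<Longrightarrow> mat_adjoint A \<in> carrier_mat m n"
  by (rule carrier_matI) auto

lemma index_mat_adjoint [simp]:
  "i < dim_col A \<Longrightarrow> j < dim_row A \<Longrightarrow> mat_adjoint A $$ (i, j) = conjugate (A $$ (j, i))"
  by (simp add: mat_adjoint_def mat_of_rows_def)

lemma mat_adjoint_adjoint [simp]: "mat_adjoint (mat_adjoint A) = A"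
  by (rule eq_matI) auto

lemma mat_adjoint_mult:
  fixes A B :: "complex mat"
  assumes "A \<in> carrier_mat n m" "B \<in> carrier_mat m k"
  shows "mat_adjoint (A * B) = mat_adjoint B * mat_adjoint A"
  using assms by (intro eq_matI) (auto simp: scalar_prod_def mult.commute)

lemma mat_adjoint_add:
  fixes A B :: "complex mat"
  assumes "A \<in> carrier_mat n m" "B \<in> carrier_mat n m"
  shows "mat_adjoint (A + B) = mat_adjoint A + mat_adjoint B"
  using assms by (intro eq_matI) auto

lemma mat_adjoint_real_diag [simp]: "mat_adjoint (real_diag n d) = real_diag n d"
  by (rule eq_matI) (auto simp: real_diag_def mat_diag_def)

lemma real_diag_carrier [simp]: "real_diag n d \<in> carrier_mat n n"
  by (simp add: real_diag_def)

lemma Herm_carrier: "A \<in> Herm n \<Longrightarrow> A \<in> carrier_mat n n"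
  by (simp add: Herm_def)

lemma Herm_adjoint: "A \<in> Herm n \<Longrightarrow> mat_adjoint A = A"
  by (simp add: Herm_def)

lemma Herm_add: "A \<in> Herm n \<Longrightarrow> B \<in> Herm n \<Longrightarrow> A + B \<in> Herm n"
  by (auto simp: Herm_def mat_adjoint_add)

lemma Herm_adjoint_conj:
  assumes "A \<in> Herm n" "U \<in> carrier_mat n n"
  shows "mat_adjoint U * A * U \<in> Herm n"
  using assms unfolding Herm_def
  by (auto simp: mat_adjoint_mult[of _ n n _ n] assoc_mult_mat[of _ n n _ n _ n] mult_carrier_mat[of _ n n _ n])

section \<open>Unitary matrices of a fixed size\<close>

definition unitary_group :: "nat \<Rightarrow> complex mat set" where
  "unitary_group n = {U \<in> carrier_mat n n. mat_adjoint U * U = 1\<^sub>m n}"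

lemma unitary_groupI:
  "U \<in> carrier_mat n n \<Longrightarrow> mat_adjoint U * U = 1\<^sub>m n \<Longrightarrow> U \<in> unitary_group n"
  by (simp add: unitary_group_def)

lemma unitary_group_iff: "U \<in> unitary_group n \<longleftrightarrow> U \<in> carrier_mat n n \<and> unitary_mat U"
  by (auto simp: unitary_group_def unitary_mat_def)

lemma unitary_group_carrier [simp]: "U \<in> unitary_group n \<Longrightarrow> U \<in> carrier_mat n n"
  by (simp add: unitary_group_def)

lemma unitary_adjoint_mult: "U \<in> unitary_group n \<Longrightarrow> mat_adjoint U * U = 1\<^sub>m n"
  unfolding unitary_group_def by blast

text \<open>A one-sided inverse of a square matrix is two-sided.\<close>

lemma unitary_mult_adjoint: "U \<in> unitary_group n \<Longrightarrow> U * mat_adjoint U = 1\<^sub>m n"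
  using mat_mult_left_right_inverse[of "mat_adjoint U" n U]
  by (simp add: unitary_adjoint_mult)

lemma unitary_adjoint: "U \<in> unitary_group n \<Longrightarrow> mat_adjoint U \<in> unitary_group n"
  by (simp add: unitary_groupI unitary_mult_adjoint)

text \<open>Stated for right-nested products, the normal form to which \<open>assoc_mult_mat\<close>
  rewrites, so that cancellation works inside long products.\<close>

lemma unitary_cancel:
  assumes "U \<in> unitary_group n" "A \<in> carrier_mat n m"
  shows "mat_adjoint U * (U * A) = A" "U * (mat_adjoint U * A) = A"
  using assms unitary_adjoint_mult[OF assms(1)] unitary_mult_adjoint[OF assms(1)]
    assoc_mult_mat[of "mat_adjoint U" n n U n A m] assoc_mult_mat[of U n n "mat_adjoint U" n A m]
  by (auto simp del: assoc_mult_mat)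

lemma unitary_mult:
  assumes U: "U \<in> unitary_group n" and V: "V \<in> unitary_group n"
  shows "U * V \<in> unitary_group n"
proof (rule unitary_groupI)
  have "mat_adjoint (U * V) * (U * V) = mat_adjoint V * (mat_adjoint U * (U * V))"
    using U V by (simp add: mat_adjoint_mult[of _ n n _ n] assoc_mult_mat[of _ n n _ n _ n] mult_carrier_mat[of _ n n _ n])
  also have "\<dots> = 1\<^sub>m n"
    using U V by (simp add: unitary_cancel[OF U, of V n] unitary_adjoint_mult)
  finally show "mat_adjoint (U * V) * (U * V) = 1\<^sub>m n" .
qed (use U V in \<open>auto intro!: mult_carrier_mat[of _ n n]\<close>)

text \<open>The sum is a diagonal entry of \<open>U * mat_adjoint U\<close>. Together with the
  column version it makes the squared moduli of the entries doubly stochastic.\<close>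

lemma unitary_row_sum:
  assumes U: "U \<in> unitary_group n" and i: "i < n"
  shows "(\<Sum>j<n. (cmod (U $$ (i, j)))\<^sup>2) = 1"
proof -
  have "complex_of_real (\<Sum>j<n. (cmod (U $$ (i, j)))\<^sup>2) = (U * mat_adjoint U) $$ (i, i)"
    using unitary_group_carrier[OF U] i
    by (auto simp: scalar_prod_def atLeast0LessThan complex_norm_square simp del: of_real_power)
  also have "\<dots> = 1" using i by (simp add: unitary_mult_adjoint[OF U])
  finally show ?thesis by (simp only: of_real_eq_1_iff)
qed

lemma unitary_col_sum:
  assumes U: "U \<in> unitary_group n" and j: "j < n"
  shows "(\<Sum>i<n. (cmod (U $$ (i, j)))\<^sup>2) = 1"
proof -
  have "(\<Sum>i<n. (cmod (U $$ (i, j)))\<^sup>2) = (\<Sum>i<n. (cmod (mat_adjoint U $$ (j, i)))\<^sup>2)"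
    using unitary_group_carrier[OF U] j by (intro sum.cong) auto
  then show ?thesis using unitary_row_sum[OF unitary_adjoint[OF U] j] by simp
qed

text \<open>Complete \<open>v\<close> to a basis, orthogonalise by Gram-Schmidt and normalise the
  resulting columns. The scalar \<open>c\<close> is the reciprocal of the norm of
  \<open>v\<close>.\<close>

lemma unitary_with_first_column:
  fixes v :: "complex vec"
  assumes v: "v \<in> carrier_vec n" and v0: "v \<noteq> 0\<^sub>v n"
  obtains W c where "W \<in> unitary_group n" "col W 0 = c \<cdot>\<^sub>v v"
proof -
  interpret cof_vec_space n "TYPE(complex)" .
  define ws where "ws = gram_schmidt n (basis_completion v)"
  note b = basis_completion[OF v v0]
  have n: "n > 0" using v v0 by (cases n) auto
  note gs = gram_schmidt_result[OF b(2,4,5) ws_def]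
  have len: "length ws = n" using gs(4) b(6) by simp
  \<comment> \<open>Gram-Schmidt leaves the head of its list unchanged, so the first orthogonal
    vector is \<open>v\<close> itself.\<close>
  have "basis_completion v = v # tl (basis_completion v)"
    using b(6,7) n by (cases "basis_completion v") auto
  then have "hd ws = v" unfolding ws_def using gram_schmidt_hd[OF v] by metis
  then have ws0: "ws ! 0 = v" using len n by (cases ws) auto
  have wsc: "ws ! i \<in> carrier_vec n" if "i < n" for i using gs(3) len that by auto
  have orth: "(ws ! i \<bullet>c ws ! j = 0) = (i \<noteq> j)" if "i < n" "j < n" for i j
    using corthogonalD[OF gs(2)] len that by auto
  \<comment> \<open>The vectors \<open>ws\<close> are orthogonal but not normalised;
    \<open>s j\<close> is the squared norm by whose root column \<open>j\<close> of \<open>W\<close>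
    is divided.\<close>
  define s where "s j = Re (ws ! j \<bullet>c ws ! j)" for j
  have s: "s j > 0" "ws ! j \<bullet>c ws ! j = of_real (s j)" if "j < n" for j
  proof -
    \<comment> \<open>Nonnegativity in the order on complex numbers includes a vanishing imaginary
      part, so the inner product equals its real part.\<close>
    have "ws ! j \<bullet>c ws ! j \<ge> 0" using conjugate_square_ge_0_vec[of "ws ! j"] wsc[OF that] by auto
    then show "ws ! j \<bullet>c ws ! j = of_real (s j)"
      by (simp add: s_def complex_eq_iff less_eq_complex_def)
    then show "s j > 0" using \<open>ws ! j \<bullet>c ws ! j \<ge> 0\<close> orth[OF that that]
      by (auto simp: s_def complex_eq_iff less_eq_complex_def order.strict_iff_order)
  qed
  define W where "W = mat n n (\<lambda>(i, j). ws ! j $ i / of_real (sqrt (s j)))"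
  have "mat_adjoint W * W = 1\<^sub>m n"
  proof (rule eq_matI)
    fix i j assume "i < dim_row (1\<^sub>m n :: complex mat)" "j < dim_col (1\<^sub>m n :: complex mat)"
    then have ij: "i < n" "j < n" by auto
    have "(mat_adjoint W * W) $$ (i, j)
        = (\<Sum>k<n. cnj (ws ! i $ k) / of_real (sqrt (s i)) * (ws ! j $ k / of_real (sqrt (s j))))"
      using ij by (simp add: scalar_prod_def atLeast0LessThan W_def)
    also have "\<dots> = (ws ! j \<bullet>c ws ! i) / (of_real (sqrt (s i)) * of_real (sqrt (s j)))"
      using wsc[OF ij(1)] wsc[OF ij(2)]
      by (simp add: scalar_prod_def atLeast0LessThan sum_divide_distrib mult_ac)
    also have "\<dots> = (if i = j then 1 else 0)"
      using s[OF ij(1)] orth[of j i] ij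
      by (auto simp flip: of_real_mult)
    finally show "(mat_adjoint W * W) $$ (i, j) = 1\<^sub>m n $$ (i, j)" using ij by simp
  qed (auto simp: W_def)
  then have "W \<in> unitary_group n" by (intro unitary_groupI) (auto simp: W_def)
  moreover have "col W 0 = (1 / of_real (sqrt (s 0))) \<cdot>\<^sub>v v"
    using v n by (intro eq_vecI) (auto simp: W_def ws0)
  ultimately show ?thesis by (rule that)
qed

section \<open>Splitting off an eigenvalue and the spectral theorem\<close>

definition unitary_diag :: "nat \<Rightarrow> complex mat \<Rightarrow> (nat \<Rightarrow> real) \<Rightarrow> complex mat" where
  "unitary_diag n U d = U * real_diag n d * mat_adjoint U"

lemma unitary_diag_carrier [simp]: "U \<in> carrier_mat n n \<Longrightarrow> unitary_diag n U d \<in> carrier_mat n n"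
  unfolding unitary_diag_def by (intro mult_carrier_mat[where n=n]) auto

lemma Herm_unitary_diag:
  assumes "U \<in> carrier_mat n n"
  shows "unitary_diag n U d \<in> Herm n"
  using Herm_adjoint_conj[of "real_diag n d" n "mat_adjoint U"] assms
  by (simp add: Herm_def unitary_diag_def)

text \<open>Hermitian symmetry carries the zeros of the first column over to the first row and makes
  the corner entry its own conjugate, hence real.\<close>

lemma four_block_unit_first_column:
  fixes B :: "complex mat"
  assumes B: "B \<in> Herm (Suc n)" and col0: "col B 0 = e \<cdot>\<^sub>v unit_vec (Suc n) 0"
  obtains r C where "C \<in> Herm n"
    "B = four_block_mat (mat 1 1 (\<lambda>_. complex_of_real r)) (0\<^sub>m 1 n) (0\<^sub>m n 1) C"
proof -
  have Bc: "B \<in> carrier_mat (Suc n) (Suc n)" using B by (rule Herm_carrier)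
  have sym: "B $$ (j, i) = cnj (B $$ (i, j))" if "i < Suc n" "j < Suc n" for i j
    using Herm_adjoint[OF B] index_mat_adjoint[of j B i] Bc that by simp
  have B0: "B $$ (i, 0) = (if i = 0 then e else 0)" if "i < Suc n" for i
    using arg_cong[OF col0, of "\<lambda>w. w $ i"] that Bc by (auto simp: unit_vec_def)
  have B0': "B $$ (0, i) = 0" if "0 < i" "i < Suc n" for i
    using B0[of i] sym[of i 0] that by simp
  define C where "C = mat n n (\<lambda>(i, j). B $$ (Suc i, Suc j))"
  have "mat_adjoint C = C"
  proof (rule eq_matI)
    fix i j assume "i < dim_row C" "j < dim_col C"
    then show "mat_adjoint C $$ (i, j) = C $$ (i, j)"
      using sym[of "Suc j" "Suc i"] by (simp add: C_def)
  qed (auto simp: C_def)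
  then have "C \<in> Herm n" by (simp add: Herm_def C_def)
  moreover have "B = four_block_mat (mat 1 1 (\<lambda>_. complex_of_real (Re e))) (0\<^sub>m 1 n) (0\<^sub>m n 1) C"
    (is "_ = ?F")
  proof (rule eq_matI)
    fix i j assume "i < dim_row ?F" "j < dim_col ?F"
    then have ij: "i < Suc n" "j < Suc n" by (auto simp: C_def)
    have e: "B $$ (0, 0) = of_real (Re e)" using B0[of 0] sym[of 0 0]
      by (auto simp: complex_eq_iff)
    show "B $$ (i, j) = ?F $$ (i, j)"
    proof (cases "i = 0 \<and> j = 0")
      case True
      then show ?thesis using e by (auto simp: C_def)
    next
      case False
      then show ?thesis using ij B0[of i] B0'[of j] by (auto simp: C_def)
    qed
  qed (use Bc in \<open>auto simp: C_def\<close>)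
  ultimately show ?thesis by (rule that)
qed

lemma mat_adjoint_four_block_diag:
  fixes A D :: "complex mat"
  assumes "A \<in> carrier_mat n n" "D \<in> carrier_mat m m"
  shows "mat_adjoint (four_block_mat A (0\<^sub>m n m) (0\<^sub>m m n) D)
    = four_block_mat (mat_adjoint A) (0\<^sub>m n m) (0\<^sub>m m n) (mat_adjoint D)"
  using assms by (intro eq_matI) auto

lemma mult_four_block_diag:
  fixes A A' D D' :: "complex mat"
  assumes "A \<in> carrier_mat n n" "D \<in> carrier_mat m m" "A' \<in> carrier_mat n n" "D' \<in> carrier_mat m m"
  shows "four_block_mat A (0\<^sub>m n m) (0\<^sub>m m n) D * four_block_mat A' (0\<^sub>m n m) (0\<^sub>m m n) D'
    = four_block_mat (A * A') (0\<^sub>m n m) (0\<^sub>m m n) (D * D')"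
  using assms by (subst mult_four_block_mat[of _ n n _ m _ m _ _ n _ m]) auto

lemma four_block_one: "four_block_mat (1\<^sub>m 1) (0\<^sub>m 1 n) (0\<^sub>m n 1) (1\<^sub>m n) = (1\<^sub>m (Suc n) :: complex mat)"
  by (intro eq_matI) (auto simp: less_Suc_eq_0_disj)

text \<open>The way back from the smaller block: a diagonalisation of the lower block extends to the
  whole matrix by a unit corner. \<open>case_nat r d\<close> puts the eigenvalue \<open>r\<close> at
  index 0 and shifts \<open>d\<close> up by one.\<close>

lemma unitary_four_block:
  assumes V: "V \<in> unitary_group n"
  defines "V' \<equiv> four_block_mat (1\<^sub>m 1) (0\<^sub>m 1 n) (0\<^sub>m n 1) V"
  shows "V' \<in> unitary_group (Suc n)"
    "four_block_mat (mat 1 1 (\<lambda>_. complex_of_real r)) (0\<^sub>m 1 n) (0\<^sub>m n 1) (unitary_diag n V d)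
      = unitary_diag (Suc n) V' (case_nat r d)"
proof -
  note Vc = unitary_group_carrier[OF V]
  have adj1: "mat_adjoint (1\<^sub>m 1) = (1\<^sub>m 1 :: complex mat)" by (rule eq_matI) auto
  have V'a: "mat_adjoint V' = four_block_mat (1\<^sub>m 1) (0\<^sub>m 1 n) (0\<^sub>m n 1) (mat_adjoint V)"
    unfolding V'_def using Vc by (subst mat_adjoint_four_block_diag) (auto simp: adj1)
  have "mat_adjoint V' * V' = four_block_mat (1\<^sub>m 1 * 1\<^sub>m 1) (0\<^sub>m 1 n) (0\<^sub>m n 1) (mat_adjoint V * V)"
    unfolding V'a unfolding V'_def using Vc by (intro mult_four_block_diag) auto
  also have "\<dots> = four_block_mat (1\<^sub>m 1) (0\<^sub>m 1 n) (0\<^sub>m n 1) (1\<^sub>m n)"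
    by (simp add: unitary_adjoint_mult[OF V])
  finally have "mat_adjoint V' * V' = 1\<^sub>m (Suc n)" by (simp only: four_block_one)
  moreover have "V' \<in> carrier_mat (Suc n) (Suc n)" unfolding V'_def using Vc by auto
  ultimately show "V' \<in> unitary_group (Suc n)" by (intro unitary_groupI)
  let ?R = "mat 1 1 (\<lambda>_. complex_of_real r)"
  have D: "real_diag (Suc n) (case_nat r d) = four_block_mat ?R (0\<^sub>m 1 n) (0\<^sub>m n 1) (real_diag n d)"
    by (rule eq_matI) (auto simp: real_diag_def mat_diag_def less_Suc_eq_0_disj)
  have "unitary_diag (Suc n) V' (case_nat r d)
      = four_block_mat (1\<^sub>m 1 * ?R) (0\<^sub>m 1 n) (0\<^sub>m n 1) (V * real_diag n d) * mat_adjoint V'"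
    unfolding unitary_diag_def D unfolding V'_def using Vc by (subst mult_four_block_diag) auto
  also have "\<dots> = four_block_mat (1\<^sub>m 1 * ?R * 1\<^sub>m 1) (0\<^sub>m 1 n) (0\<^sub>m n 1) (unitary_diag n V d)"
    unfolding unitary_diag_def V'a using Vc
    by (subst mult_four_block_diag) (auto intro!: mult_carrier_mat[of _ n n])
  also have "1\<^sub>m 1 * ?R * 1\<^sub>m 1 = ?R" by (simp add: left_mult_one_mat[of _ 1 1] right_mult_one_mat[of _ 1 1])
  finally show "four_block_mat ?R (0\<^sub>m 1 n) (0\<^sub>m n 1) (unitary_diag n V d)
      = unitary_diag (Suc n) V' (case_nat r d)" ..
qed

text \<open>Induction on the size: conjugating by a unitary whose first column is an eigenvector
  splits off a real eigenvalue and leaves a Hermitian block one size smaller.\<close>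

theorem Herm_unitary_diag_exists:
  assumes "A \<in> Herm n"
  obtains U d where "U \<in> unitary_group n" "A = unitary_diag n U d"
  using assms
proof (induction n arbitrary: A thesis)
  case 0
  have "A = unitary_diag 0 (1\<^sub>m 0) (\<lambda>_. 0)"
    using Herm_carrier[OF "0.prems"(2)] by (intro eq_matI) (auto simp: unitary_diag_def)
  moreover have "1\<^sub>m 0 \<in> unitary_group 0" by (intro unitary_groupI eq_matI) auto
  ultimately show ?case using "0.prems"(1) by blast
next
  case (Suc n)
  let ?N = "Suc n"
  have A: "A \<in> carrier_mat ?N ?N" using Suc.prems(2) by (rule Herm_carrier)
  \<comment> \<open>The characteristic polynomial has positive degree, so it has a complex root,
    which is an eigenvalue.\<close>
  have "degree (char_poly A) = ?N" using degree_monic_char_poly[OF A] by simp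
  then have "\<not> constant (poly (char_poly A))" by (simp add: constant_degree)
  then obtain e where "poly (char_poly A) e = 0" using fundamental_theorem_of_algebra by blast
  then have "eigenvalue A e" by (simp add: eigenvalue_root_char_poly[OF A])
  then obtain v where "eigenvector A v e" unfolding eigenvalue_def by auto
  then have v: "v \<in> carrier_vec ?N" "v \<noteq> 0\<^sub>v ?N" "A *\<^sub>v v = e \<cdot>\<^sub>v v"
    using A by (auto simp: eigenvector_def)
  from unitary_with_first_column[OF v(1,2)] obtain W c
    where W: "W \<in> unitary_group ?N" and W0: "col W 0 = c \<cdot>\<^sub>v v" by blast
  note Wc = unitary_group_carrier[OF W]
  define B where "B = mat_adjoint W * A * W"
  have Wv: "col W 0 \<in> carrier_vec ?N" using Wc by (metis carrier_matD(1) col_dim)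
  \<comment> \<open>The first column of \<open>W\<close> is a multiple of the eigenvector
    \<open>v\<close>, so \<open>A\<close> scales it by \<open>e\<close>, and
    \<open>mat_adjoint W\<close> then sends it to the first unit vector.\<close>
  have "col B 0 = (mat_adjoint W * A) *\<^sub>v col W 0"
    unfolding B_def using A Wc by (intro col_mult2[of _ ?N ?N _ ?N]) (auto intro: mult_carrier_mat)
  also have "\<dots> = mat_adjoint W *\<^sub>v (A *\<^sub>v col W 0)"
    using A Wc Wv by (intro assoc_mult_mat_vec) auto
  also have "A *\<^sub>v col W 0 = e \<cdot>\<^sub>v col W 0"
    unfolding W0 using v(1) by (simp only: mult_mat_vec[OF A v(1)] v(3) smult_smult_assoc mult.commute)
  also have "mat_adjoint W *\<^sub>v (e \<cdot>\<^sub>v col W 0) = e \<cdot>\<^sub>v (mat_adjoint W *\<^sub>v col W 0)"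
    using Wc Wv by (intro mult_mat_vec) auto
  also have "mat_adjoint W *\<^sub>v col W 0 = col (mat_adjoint W * W) 0"
    using Wc by (intro col_mult2[symmetric, of _ ?N ?N _ ?N]) auto
  also have "\<dots> = unit_vec ?N 0" by (simp add: unitary_adjoint_mult[OF W])
  finally have col0: "col B 0 = e \<cdot>\<^sub>v unit_vec ?N 0" .
  have "B \<in> Herm ?N" unfolding B_def using Suc.prems(2) Wc by (rule Herm_adjoint_conj)
  from four_block_unit_first_column[OF this col0] obtain r C where C: "C \<in> Herm n"
    and B: "B = four_block_mat (mat 1 1 (\<lambda>_. complex_of_real r)) (0\<^sub>m 1 n) (0\<^sub>m n 1) C"
    by blast
  from Suc.IH[OF _ C] obtain V d where V: "V \<in> unitary_group n" and CV: "C = unitary_diag n V d"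
    by blast
  define V' where "V' = four_block_mat (1\<^sub>m 1) (0\<^sub>m 1 n) (0\<^sub>m n 1) V"
  have V': "V' \<in> unitary_group ?N" unfolding V'_def by (rule unitary_four_block(1)[OF V])
  have "B = unitary_diag ?N V' (case_nat r d)"
    unfolding B CV V'_def by (rule unitary_four_block(2)[OF V])
  \<comment> \<open>Undoing the conjugation turns the diagonalisation of \<open>B\<close> by
    \<open>V'\<close> into one of \<open>A\<close> by \<open>W * V'\<close>.\<close>
  moreover have "A = W * B * mat_adjoint W"
  proof -
    have "W * B * mat_adjoint W = W * (mat_adjoint W * (A * (W * mat_adjoint W)))"
      unfolding B_def using A Wc
      by (simp add: mult_carrier_mat[of _ ?N ?N _ ?N] assoc_mult_mat[of _ ?N ?N _ ?N _ ?N])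
    then show ?thesis using A by (simp add: unitary_mult_adjoint[OF W] unitary_cancel[OF W, of A])
  qed
  ultimately have "A = unitary_diag ?N (W * V') (case_nat r d)"
    using Wc unitary_group_carrier[OF V']
    by (simp add: unitary_diag_def mat_adjoint_mult[of _ ?N ?N _ ?N] mult_carrier_mat[of _ ?N ?N _ ?N]
        assoc_mult_mat[of _ ?N ?N _ ?N _ ?N])
  then show ?case using Suc.prems(1) unitary_mult[OF W V'] by blast
qed

section \<open>Spectral calculus\<close>

lemma index_unitary_diag:
  assumes "U \<in> carrier_mat n n" "i < n" "j < n"
  shows "unitary_diag n U d $$ (i, j)
    = (\<Sum>k<n. U $$ (i, k) * complex_of_real (d k) * cnj (U $$ (j, k)))"
  using assms by (auto simp: unitary_diag_def real_diag_def mat_diag_mult_right[of U n n]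
      scalar_prod_def atLeast0LessThan)

text \<open>With \<open>W = mat_adjoint V * U\<close> the equality says that \<open>W\<close>
  intertwines the two diagonal matrices. Read entrywise, it says that wherever \<open>W\<close> has
  a nonzero entry the eigenvalues \<open>d j\<close> and \<open>e i\<close> agree.\<close>

lemma unitary_diag_intertwine:
  assumes U: "U \<in> unitary_group n" and V: "V \<in> unitary_group n"
  shows "unitary_diag n U d = unitary_diag n V e \<longleftrightarrow>
    (\<forall>i<n. \<forall>j<n. (mat_adjoint V * U) $$ (i, j) * of_real (d j) = of_real (e i) * (mat_adjoint V * U) $$ (i, j))"
proof -
  note Uc = unitary_group_carrier[OF U] and Vc = unitary_group_carrier[OF V]
  note assoc = assoc_mult_mat[of _ n n _ n _ n] and mc = mult_carrier_mat[of _ n n _ n]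
  let ?W = "mat_adjoint V * U"
  have "unitary_diag n U d = unitary_diag n V e \<longleftrightarrow> ?W * real_diag n d = real_diag n e * ?W"
  proof
    assume eq: "unitary_diag n U d = unitary_diag n V e"
    have "?W * real_diag n d = mat_adjoint V * unitary_diag n U d * U"
      using Uc Vc by (simp add: unitary_diag_def assoc mc unitary_adjoint_mult[OF U]
          right_mult_one_mat[of _ n n])
    also have "\<dots> = real_diag n e * ?W"
      using Uc Vc unfolding eq by (simp add: unitary_diag_def assoc mc unitary_cancel[OF V, of _ n])
    finally show "?W * real_diag n d = real_diag n e * ?W" .
  next
    assume eq: "?W * real_diag n d = real_diag n e * ?W"
    have "unitary_diag n U d = V * (?W * real_diag n d) * mat_adjoint U"
      using Uc Vc by (simp add: unitary_diag_def assoc mc unitary_cancel[OF V, of _ n])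
    also have "\<dots> = unitary_diag n V e"
      using Uc Vc unfolding eq by (simp add: unitary_diag_def assoc mc unitary_mult_adjoint[OF U])
    finally show "unitary_diag n U d = unitary_diag n V e" .
  qed
  moreover have "?W * real_diag n d = mat n n (\<lambda>(i, j). ?W $$ (i, j) * of_real (d j))"
    unfolding real_diag_def using Uc Vc by (intro mat_diag_mult_right mc) auto
  moreover have "real_diag n e * ?W = mat n n (\<lambda>(i, j). of_real (e i) * ?W $$ (i, j))"
    unfolding real_diag_def using Uc Vc by (intro mat_diag_mult_left mc) auto
  ultimately show ?thesis by (simp add: mat_eq_iff)
qed

text \<open>Each entry of the intertwining matrix is zero or has \<open>d j = e i\<close>; in both
  cases the relation survives applying \<open>f\<close>. This is the well-definedness of the
  spectral calculus.\<close>

lemma unitary_diag_fun_cong: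
  assumes U: "U \<in> unitary_group n" and V: "V \<in> unitary_group n"
    and eq: "unitary_diag n U d = unitary_diag n V e"
  shows "unitary_diag n U (\<lambda>i. f (d i)) = unitary_diag n V (\<lambda>i. f (e i))"
  using eq unfolding unitary_diag_intertwine[OF U V]
  by (metis mult.commute mult_cancel_right of_real_eq_iff)

text \<open>Resolves the \<open>THE\<close> in \<open>spectral_fun\<close>: the given
  diagonalisation is a witness, and any other one yields the same matrix by
  \<open>unitary_diag_fun_cong\<close>.\<close>

lemma spectral_fun_unitary_diag:
  assumes U: "U \<in> unitary_group n"
  shows "spectral_fun f (unitary_diag n U d) = unitary_diag n U (\<lambda>i. f (d i))"
proof -
  have dim: "dim_row (unitary_diag n U d) = n"
    using unitary_diag_carrier[OF unitary_group_carrier[OF U], of d] by simp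
  show ?thesis
    unfolding spectral_fun_def dim unitary_diag_def[symmetric]
  proof (rule the_equality)
    show "\<exists>V e. V \<in> carrier_mat n n \<and> unitary_mat V \<and> unitary_diag n U d = unitary_diag n V e \<and>
        unitary_diag n U (\<lambda>i. f (d i)) = unitary_diag n V (\<lambda>i. f (e i))"
      using U unfolding unitary_group_iff by blast
  next
    fix B
    assume "\<exists>V e. V \<in> carrier_mat n n \<and> unitary_mat V \<and> unitary_diag n U d = unitary_diag n V e \<and>
        B = unitary_diag n V (\<lambda>i. f (e i))"
    then show "B = unitary_diag n U (\<lambda>i. f (d i))"
      using unitary_diag_fun_cong[OF U] unfolding unitary_group_iff by metis
  qed
qed

lemma Herm_spectral_fun:
  assumes "A \<in> Herm n"
  shows "spectral_fun f A \<in> Herm n"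
  using Herm_unitary_diag_exists[OF assms]
  by (metis spectral_fun_unitary_diag Herm_unitary_diag unitary_group_carrier)

lemma unitary_diag_mult:
  assumes U: "U \<in> unitary_group n"
  shows "unitary_diag n U d * unitary_diag n U e = unitary_diag n U (\<lambda>i. d i * e i)"
proof -
  note Uc = unitary_group_carrier[OF U]
  note assoc = assoc_mult_mat[of _ n n _ n _ n] and mc = mult_carrier_mat[of _ n n _ n]
  have "unitary_diag n U d * unitary_diag n U e = U * (real_diag n d * real_diag n e) * mat_adjoint U"
    using Uc by (simp add: unitary_diag_def assoc mc unitary_cancel[OF U, of _ n])
  also have "real_diag n d * real_diag n e = real_diag n (\<lambda>i. d i * e i)"
    by (simp add: real_diag_def)
  finally show ?thesis by (simp add: unitary_diag_def)
qed

lemma unitary_diag_pow: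
  assumes U: "U \<in> unitary_group n"
  shows "unitary_diag n U d ^\<^sub>m k = unitary_diag n U (\<lambda>i. d i ^ k)"
proof (induction k)
  case 0
  have "unitary_diag n U (\<lambda>i. d i ^ 0) = 1\<^sub>m n"
    using U by (simp add: unitary_diag_def real_diag_def unitary_mult_adjoint right_mult_one_mat[of _ n n])
  moreover have "dim_row (unitary_diag n U d) = n"
    using unitary_diag_carrier[OF unitary_group_carrier[OF U], of d] by simp
  ultimately show ?case by simp
next
  case (Suc k)
  then show ?case by (simp add: unitary_diag_mult[OF U] mult.commute)
qed

text \<open>Connects the power series \<open>mat_exp\<close> with the spectral picture. An entry of
  the \<open>k\<close>-th power is a finite combination of the \<open>d l ^ k\<close> with
  coefficients independent of \<open>k\<close>, so the series is a finite sum of scalar exponential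
  series.\<close>

lemma mat_exp_unitary_diag:
  assumes U: "U \<in> unitary_group n"
  shows "mat_exp (unitary_diag n U d) = unitary_diag n U (\<lambda>i. exp (d i))"
proof -
  note Uc = unitary_group_carrier[OF U]
  have dim: "dim_row (unitary_diag n U e) = n" "dim_col (unitary_diag n U e) = n" for e
    using unitary_diag_carrier[OF Uc, of e] by auto
  have "(\<Sum>k. (unitary_diag n U d ^\<^sub>m k) $$ (i, j) / fact k) = unitary_diag n U (\<lambda>i. exp (d i)) $$ (i, j)"
    if ij: "i < n" "j < n" for i j
  proof -
    have "(\<lambda>k. \<Sum>l<n. U $$ (i, l) * cnj (U $$ (j, l)) * (complex_of_real (d l) ^ k /\<^sub>R fact k))
        sums (\<Sum>l<n. U $$ (i, l) * cnj (U $$ (j, l)) * exp (complex_of_real (d l)))"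
      by (intro sums_sum sums_mult exp_converges)
    moreover have "(\<Sum>l<n. U $$ (i, l) * cnj (U $$ (j, l)) * (complex_of_real (d l) ^ k /\<^sub>R fact k))
        = (unitary_diag n U d ^\<^sub>m k) $$ (i, j) / fact k" for k
      by (simp add: unitary_diag_pow[OF U] index_unitary_diag[OF Uc ij] sum_distrib_left
          scaleR_conv_of_real divide_inverse mult_ac)
    moreover have "(\<Sum>l<n. U $$ (i, l) * cnj (U $$ (j, l)) * exp (complex_of_real (d l)))
        = unitary_diag n U (\<lambda>i. exp (d i)) $$ (i, j)"
      by (simp add: index_unitary_diag[OF Uc ij] exp_of_real mult_ac)
    ultimately show ?thesis by (simp add: sums_iff)
  qed
  then show ?thesis unfolding mat_exp_def by (intro eq_matI) (auto simp: dim)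
qed

section \<open>Traces and positivity\<close>

lemma mtrace_add:
  "A \<in> carrier_mat n n \<Longrightarrow> B \<in> carrier_mat n n \<Longrightarrow> mtrace (A + B) = mtrace A + mtrace B"
  by (auto simp: mtrace_def sum.distrib)

lemma mtrace_diff:
  "A \<in> carrier_mat n n \<Longrightarrow> B \<in> carrier_mat n n \<Longrightarrow> mtrace (A - B) = mtrace A - mtrace B"
  by (auto simp: mtrace_def sum_subtractf)

lemma mtrace_mult_commute:
  assumes "A \<in> carrier_mat n m" "B \<in> carrier_mat m n"
  shows "mtrace (A * B) = mtrace (B * A)"
proof -
  have "mtrace (A * B) = (\<Sum>i<n. \<Sum>j<m. A $$ (i, j) * B $$ (j, i))"
    using assms by (auto simp: mtrace_def scalar_prod_def atLeast0LessThan)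
  also have "\<dots> = (\<Sum>j<m. \<Sum>i<n. A $$ (i, j) * B $$ (j, i))" by (rule sum.swap)
  also have "\<dots> = mtrace (B * A)"
    using assms by (auto simp: mtrace_def scalar_prod_def atLeast0LessThan mult.commute)
  finally show ?thesis .
qed

text \<open>Cyclicity of the trace moves \<open>U\<close> to the right end, which leaves a diagonal
  matrix times \<open>unitary_diag n W e\<close> with \<open>W = mat_adjoint U * V\<close>. The
  squared moduli come from the diagonal entries of the latter.\<close>

lemma mtrace_unitary_diag_mult:
  assumes U: "U \<in> unitary_group n" and V: "V \<in> unitary_group n"
  shows "mtrace (unitary_diag n U d * unitary_diag n V e)
    = of_real (\<Sum>i<n. \<Sum>j<n. d i * e j * (cmod ((mat_adjoint U * V) $$ (i, j)))\<^sup>2)"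
proof -
  note Uc = unitary_group_carrier[OF U] and Vc = unitary_group_carrier[OF V]
  note assoc = assoc_mult_mat[of _ n n _ n _ n] and mc = mult_carrier_mat[of _ n n _ n]
  define W where "W = mat_adjoint U * V"
  have Wc: "W \<in> carrier_mat n n" unfolding W_def using Uc Vc by (intro mc) auto
  have "mtrace (unitary_diag n U d * unitary_diag n V e)
      = mtrace (U * (real_diag n d * (mat_adjoint U * unitary_diag n V e)))"
    unfolding unitary_diag_def[of n U] using Uc Vc by (simp add: assoc mc)
  also have "\<dots> = mtrace (real_diag n d * (mat_adjoint U * unitary_diag n V e) * U)"
    using Uc Vc by (intro mtrace_mult_commute[of _ n n]) (auto intro!: mc)
  also have "real_diag n d * (mat_adjoint U * unitary_diag n V e) * U = real_diag n d * unitary_diag n W e"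
    unfolding unitary_diag_def W_def using Uc Vc by (simp add: assoc mc mat_adjoint_mult[of _ n n _ n])
  also have "\<dots> = mat n n (\<lambda>(i, j). of_real (d i) * unitary_diag n W e $$ (i, j))"
    unfolding real_diag_def using Wc by (intro mat_diag_mult_left) auto
  also have "mtrace \<dots> = (\<Sum>i<n. of_real (d i) * unitary_diag n W e $$ (i, i))"
    by (simp add: mtrace_def)
  also have "\<dots> = of_real (\<Sum>i<n. \<Sum>j<n. d i * e j * (cmod (W $$ (i, j)))\<^sup>2)"
    by (auto simp: index_unitary_diag[OF Wc] sum_distrib_left complex_norm_square mult_ac
        simp del: of_real_power intro!: sum.cong)
  finally show ?thesis unfolding W_def .
qed

lemma mtrace_unitary_diag:
  assumes U: "U \<in> unitary_group n"
  shows "mtrace (unitary_diag n U d) = of_real (\<Sum>i<n. d i)"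
proof -
  note Uc = unitary_group_carrier[OF U]
  have "mtrace (unitary_diag n U d) = mtrace (U * (real_diag n d * mat_adjoint U))"
    using Uc by (simp add: unitary_diag_def assoc_mult_mat[of _ n n _ n _ n])
  also have "\<dots> = mtrace (real_diag n d * mat_adjoint U * U)"
    using Uc by (intro mtrace_mult_commute[of _ n n]) (auto intro!: mult_carrier_mat[of _ n n])
  also have "\<dots> = mtrace (real_diag n d)"
    using Uc by (simp add: assoc_mult_mat[of _ n n _ n _ n] unitary_adjoint_mult[OF U]
        right_mult_one_mat[of _ n n])
  also have "\<dots> = of_real (\<Sum>i<n. d i)"
    by (simp add: mtrace_def real_diag_def mat_diag_def)
  finally show ?thesis .
qed

section \<open>Quadratic forms and positive semidefiniteness\<close>

lemma cscalar_prod_mult_mat_vec: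
  fixes A :: "complex mat"
  assumes "A \<in> carrier_mat n m" "x \<in> carrier_vec m" "y \<in> carrier_vec n"
  shows "(A *\<^sub>v x) \<bullet>c y = x \<bullet>c (mat_adjoint A *\<^sub>v y)"
proof -
  have "(A *\<^sub>v x) \<bullet>c y = (\<Sum>i<n. \<Sum>j<m. A $$ (i, j) * x $ j * cnj (y $ i))"
    using assms by (auto simp: scalar_prod_def atLeast0LessThan sum_distrib_right)
  also have "\<dots> = (\<Sum>j<m. \<Sum>i<n. A $$ (i, j) * x $ j * cnj (y $ i))" by (rule sum.swap)
  also have "\<dots> = x \<bullet>c (mat_adjoint A *\<^sub>v y)"
    using assms by (auto simp: scalar_prod_def atLeast0LessThan sum_distrib_left mult_ac)
  finally show ?thesis .
qed

text \<open>In the coordinates \<open>mat_adjoint U *\<^sub>v v\<close> the form is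
  diagonal.\<close>

lemma unitary_diag_quadratic_form:
  assumes U: "U \<in> carrier_mat n n" and v: "v \<in> carrier_vec n"
  shows "(unitary_diag n U d *\<^sub>v v) \<bullet>c v = of_real (\<Sum>k<n. d k * (cmod ((mat_adjoint U *\<^sub>v v) $ k))\<^sup>2)"
proof -
  define w where "w = mat_adjoint U *\<^sub>v v"
  have w: "w \<in> carrier_vec n" unfolding w_def using U v by (intro mult_mat_vec_carrier) auto
  have "unitary_diag n U d *\<^sub>v v = U *\<^sub>v (real_diag n d *\<^sub>v w)"
    unfolding unitary_diag_def w_def using U v
    by (simp add: assoc_mult_mat_vec[of _ n n _ n] assoc_mult_mat[of _ n n _ n _ n] mult_carrier_mat[of _ n n _ n])
  then have "(unitary_diag n U d *\<^sub>v v) \<bullet>c v = (real_diag n d *\<^sub>v w) \<bullet>c w"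
    using U v w by (simp add: cscalar_prod_mult_mat_vec[of U n n] mult_mat_vec_carrier[of _ n n] flip: w_def)
  also have "real_diag n d *\<^sub>v w = vec n (\<lambda>k. of_real (d k) * w $ k)"
  proof (rule eq_vecI)
    fix i assume "i < dim_vec (vec n (\<lambda>k. of_real (d k) * w $ k))"
    then have i: "i < n" by simp
    have "(real_diag n d *\<^sub>v w) $ i = (\<Sum>j<n. (if i = j then of_real (d j) else 0) * w $ j)"
      using i carrier_vecD[OF w]
      by (simp add: real_diag_def mat_diag_def scalar_prod_def atLeast0LessThan)
    also have "\<dots> = (\<Sum>j<n. if i = j then of_real (d i) * w $ i else 0)" by (intro sum.cong) auto
    finally show "(real_diag n d *\<^sub>v w) $ i = vec n (\<lambda>k. of_real (d k) * w $ k) $ i"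
      using i by simp
  qed (simp add: real_diag_def mat_diag_def)
  also have "\<dots> \<bullet>c w = of_real (\<Sum>k<n. d k * (cmod (w $ k))\<^sup>2)"
    using w by (simp add: scalar_prod_def atLeast0LessThan complex_norm_square mult_ac del: of_real_power)
  finally show ?thesis unfolding w_def .
qed

text \<open>Nonnegative eigenvalues make the diagonalised form a sum of nonnegative terms.
  Conversely, its value at the \<open>k\<close>-th column of \<open>U\<close> is exactly
  \<open>d k\<close>.\<close>

lemma pos_semidef_unitary_diag_iff:
  assumes U: "U \<in> unitary_group n"
  shows "pos_semidef (unitary_diag n U d) \<longleftrightarrow> (\<forall>k<n. 0 \<le> d k)"
proof
  note Uc = unitary_group_carrier[OF U]
  have dim: "dim_row (unitary_diag n U d) = n" using unitary_diag_carrier[OF Uc, of d] by simp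
  show "pos_semidef (unitary_diag n U d)" if "\<forall>k<n. 0 \<le> d k"
    using that unfolding pos_semidef_def dim
    by (auto simp: Herm_unitary_diag[OF Uc] unitary_diag_quadratic_form[OF Uc] intro!: sum_nonneg)
  assume psd: "pos_semidef (unitary_diag n U d)"
  show "\<forall>k<n. 0 \<le> d k"
  proof (intro allI impI)
    fix k assume k: "k < n"
    have c: "col U k \<in> carrier_vec n" using Uc by (metis carrier_matD(1) col_dim)
    have "mat_adjoint U *\<^sub>v col U k = col (mat_adjoint U * U) k"
      using Uc k by (intro col_mult2[symmetric, of _ n n _ n]) auto
    also have "\<dots> = unit_vec n k" using k by (simp add: unitary_adjoint_mult[OF U])
    finally have "(unitary_diag n U d *\<^sub>v col U k) \<bullet>c col U k
        = of_real (\<Sum>l<n. d l * (cmod (unit_vec n k $ l))\<^sup>2)"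
      using unitary_diag_quadratic_form[OF Uc c] by simp
    also have "(\<Sum>l<n. d l * (cmod (unit_vec n k $ l))\<^sup>2) = (\<Sum>l<n. if l = k then d k else 0)"
      by (intro sum.cong) (auto simp: unit_vec_def)
    also have "\<dots> = d k" using k by simp
    finally show "0 \<le> d k" using psd c unfolding pos_semidef_def dim by force
  qed
qed

section \<open>The Gibbs variational principle\<close>

text \<open>For positive \<open>p\<close> this is the tangent bound \<open>1 + x \<le> exp x\<close>
  at \<open>x = h - ln p\<close>, multiplied by \<open>p\<close>. For \<open>p = 0\<close> the left
  side vanishes.\<close>

lemma exp_young_ineq:
  fixes p h :: real
  assumes "0 \<le> p"
  shows "h * p + p - (if p = 0 then 0 else p * ln p) \<le> exp h"
proof (cases "p = 0")
  case False
  then have p: "p > 0" using assms by simp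
  have "p * (1 + (h - ln p)) \<le> p * exp (h - ln p)"
    using p by (intro mult_left_mono exp_ge_add_one_self) auto
  also have "\<dots> = exp h" using p by (simp add: exp_diff)
  finally show ?thesis using False by (simp add: algebra_simps)
qed simp

text \<open>\<open>H\<close> and \<open>\<rho>\<close> need not commute, so each gets its own
  eigenbasis; the squared overlaps \<open>w i j\<close> of the two bases reduce the claim to scalar
  inequalities.\<close>

lemma trace_exp_variational:
  assumes H: "H \<in> Herm n" and \<rho>: "\<rho> \<in> Herm n" and psd: "pos_semidef \<rho>"
  shows "Re (mtrace (H * \<rho>)) + Re (mtrace \<rho>) - Re (mtrace (mat_xlnx \<rho>)) \<le> Re (mtrace (mat_exp H))"
proof -
  obtain V h where V: "V \<in> unitary_group n" and Hd: "H = unitary_diag n V h"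
    using Herm_unitary_diag_exists[OF H] by blast
  obtain U p where U: "U \<in> unitary_group n" and \<rho>d: "\<rho> = unitary_diag n U p"
    using Herm_unitary_diag_exists[OF \<rho>] by blast
  have p: "0 \<le> p j" if "j < n" for j
    using psd that unfolding \<rho>d pos_semidef_unitary_diag_iff[OF U] by blast
  define g where "g x = (if x = 0 then 0 else x * ln x)" for x :: real
  define w where "w i j = (cmod ((mat_adjoint V * U) $$ (i, j)))\<^sup>2" for i j
  have W: "mat_adjoint V * U \<in> unitary_group n"
    using unitary_mult[OF unitary_adjoint[OF V] U] .
  have row: "(\<Sum>j<n. w i j) = 1" if "i < n" for i
    unfolding w_def using unitary_row_sum[OF W that] .
  have col: "(\<Sum>i<n. w i j) = 1" if "j < n" for j
    unfolding w_def using unitary_col_sum[OF W that] .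
  \<comment> \<open>Unit column sums let the terms in \<open>p\<close> alone be written with the
    same weights as the mixed term, so all three merge into one double sum.\<close>
  have spread: "(\<Sum>j<n. f j) = (\<Sum>i<n. \<Sum>j<n. f j * w i j)" for f :: "nat \<Rightarrow> real"
    using col by (subst sum.swap) (simp flip: sum_distrib_left)
  have "Re (mtrace (H * \<rho>)) + Re (mtrace \<rho>) - Re (mtrace (mat_xlnx \<rho>))
      = (\<Sum>i<n. \<Sum>j<n. h i * p j * w i j) + (\<Sum>j<n. p j) - (\<Sum>j<n. g (p j))"
    unfolding Hd \<rho>d mat_xlnx_def spectral_fun_unitary_diag[OF U] mtrace_unitary_diag[OF U]
      mtrace_unitary_diag_mult[OF V U] w_def g_def by simp
  also have "\<dots> = (\<Sum>i<n. \<Sum>j<n. (h i * p j + p j - g (p j)) * w i j)"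
    unfolding spread[of p] spread[of "\<lambda>j. g (p j)"]
    by (simp add: sum.distrib sum_subtractf algebra_simps)
  \<comment> \<open>The scalar inequality is applied to each pair \<open>i\<close>, \<open>j\<close>
    with weight \<open>w i j \<ge> 0\<close>; unit row sums then remove the weights.\<close>
  also have "\<dots> \<le> (\<Sum>i<n. \<Sum>j<n. exp (h i) * w i j)"
    using exp_young_ineq[OF p] by (intro sum_mono mult_right_mono) (auto simp: g_def w_def)
  also have "\<dots> = (\<Sum>i<n. exp (h i))"
    using row by (simp flip: sum_distrib_left)
  also have "\<dots> = Re (mtrace (mat_exp H))"
    unfolding Hd mat_exp_unitary_diag[OF V] mtrace_unitary_diag[OF V] by simp
  finally show ?thesis .
qed

text \<open>The maximiser \<open>mat_exp H\<close> has the eigenvectors of \<open>H\<close> and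
  logarithm \<open>H\<close>, so the first and third terms cancel and its own trace remains.\<close>

lemma trace_exp_variational_attained:
  assumes H: "H \<in> Herm n"
  obtains \<rho> where "\<rho> \<in> Herm n" "pos_semidef \<rho>"
    "Re (mtrace (H * \<rho>)) + Re (mtrace \<rho>) - Re (mtrace (mat_xlnx \<rho>)) = Re (mtrace (mat_exp H))"
proof -
  obtain V h where V: "V \<in> unitary_group n" and Hd: "H = unitary_diag n V h"
    using Herm_unitary_diag_exists[OF H] by blast
  let ?\<rho> = "mat_exp H"
  have \<rho>: "?\<rho> = unitary_diag n V (\<lambda>i. exp (h i))"
    unfolding Hd by (rule mat_exp_unitary_diag[OF V])
  \<comment> \<open>Both matrices have eigenvalues \<open>h i * exp (h i)\<close> in the basis
    \<open>V\<close>, because \<open>exp (h i)\<close> is nonzero and \<open>ln\<close> inverts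
    \<open>exp\<close>.\<close>
  have "mtrace (H * ?\<rho>) = mtrace (mat_xlnx ?\<rho>)"
    unfolding \<rho> mat_xlnx_def spectral_fun_unitary_diag[OF V] unfolding Hd
    by (simp add: unitary_diag_mult[OF V] mult.commute)
  moreover have "?\<rho> \<in> Herm n" "pos_semidef ?\<rho>"
    unfolding \<rho> pos_semidef_unitary_diag_iff[OF V]
    using Herm_unitary_diag[OF unitary_group_carrier[OF V]] by auto
  ultimately show ?thesis by (intro that) auto
qed

text \<open>The term \<open>\<rho> * mat_ln \<rho>0\<close> is linear in \<open>\<rho>\<close>, so
  by cyclicity of the trace it joins \<open>\<sigma>\<close> in \<open>H\<close>. Apart from a
  constant, the objective becomes that of the Gibbs principle.\<close>

lemma QKL_eq:
  assumes \<rho>0: "\<rho>0 \<in> Herm n" and \<sigma>: "\<sigma> \<in> Herm n" and \<rho>: "\<rho> \<in> Herm n" and psd: "pos_semidef \<rho>"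
  defines "H \<equiv> \<sigma> + mat_ln \<rho>0"
  shows "ereal (Re (mtrace (\<sigma> * \<rho>))) - QKL \<rho> \<rho>0
    = ereal (Re (mtrace (H * \<rho>)) + Re (mtrace \<rho>) - Re (mtrace (mat_xlnx \<rho>)) - Re (mtrace \<rho>0))"
proof -
  have L: "mat_ln \<rho>0 \<in> Herm n" unfolding mat_ln_def using \<rho>0 by (rule Herm_spectral_fun)
  have X: "mat_xlnx \<rho> \<in> Herm n" unfolding mat_xlnx_def using \<rho> by (rule Herm_spectral_fun)
  note c = Herm_carrier[OF \<rho>0] Herm_carrier[OF \<sigma>] Herm_carrier[OF \<rho>] Herm_carrier[OF L] Herm_carrier[OF X]
  have "mtrace (H * \<rho>) = mtrace (\<sigma> * \<rho>) + mtrace (\<rho> * mat_ln \<rho>0)"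
    unfolding H_def using c
    by (simp add: add_mult_distrib_mat[of _ n n _ _ n] mtrace_add[of _ n] mult_carrier_mat[of _ n n _ n]
        mtrace_mult_commute[of "mat_ln \<rho>0" n n])
  moreover have "mtrace (\<rho>0 - \<rho> + mat_xlnx \<rho> - \<rho> * mat_ln \<rho>0)
      = mtrace \<rho>0 - mtrace \<rho> + mtrace (mat_xlnx \<rho>) - mtrace (\<rho> * mat_ln \<rho>0)"
    using c by (simp add: mtrace_add[of _ n] mtrace_diff[of _ n] mult_carrier_mat[of _ n n _ n]
        minus_carrier_mat[of _ n n] add_carrier_mat[of _ n n])
  ultimately show ?thesis using psd by (simp add: QKL_def)
qed

theorem lemma3p2:
  fixes N :: nat and \<rho>0 \<sigma> :: "complex mat"
  assumes "\<rho>0 \<in> Herm N"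
    and "pos_semidef \<rho>0"
    and "vec_space.rank N \<rho>0 = N"
    and "\<sigma> \<in> Herm N"
  shows "herm_conjugate N (\<lambda>\<rho>. QKL \<rho> \<rho>0) \<sigma> =
    ereal (Re (mtrace (mat_exp (\<sigma> + mat_ln \<rho>0) - \<rho>0)))"
proof -
  let ?H = "\<sigma> + mat_ln \<rho>0"
  let ?F = "\<lambda>\<rho>. ereal (Re (mtrace (\<sigma> * \<rho>))) - QKL \<rho> \<rho>0"
  have H: "?H \<in> Herm N"
    unfolding mat_ln_def using assms(1,4) by (intro Herm_add Herm_spectral_fun)
  have "mat_exp ?H \<in> carrier_mat N N"
    using Herm_carrier[OF H] by (auto simp: mat_exp_def)
  then have rhs: "Re (mtrace (mat_exp ?H - \<rho>0)) = Re (mtrace (mat_exp ?H)) - Re (mtrace \<rho>0)"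
    using Herm_carrier[OF assms(1)] by (simp add: mtrace_diff[of _ N])
  obtain \<rho> where \<rho>: "\<rho> \<in> Herm N" "pos_semidef \<rho>"
    "Re (mtrace (?H * \<rho>)) + Re (mtrace \<rho>) - Re (mtrace (mat_xlnx \<rho>)) = Re (mtrace (mat_exp ?H))"
    using trace_exp_variational_attained[OF H] by blast
  have "(SUP \<rho> \<in> Herm N. ?F \<rho>) = ereal (Re (mtrace (mat_exp ?H - \<rho>0)))"
  proof (rule antisym)
    show "(SUP \<rho> \<in> Herm N. ?F \<rho>) \<le> ereal (Re (mtrace (mat_exp ?H - \<rho>0)))"
    proof (rule SUP_least)
      fix \<tau> assume \<tau>: "\<tau> \<in> Herm N"
      show "?F \<tau> \<le> ereal (Re (mtrace (mat_exp ?H - \<rho>0)))"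
      proof (cases "pos_semidef \<tau>")
        case True
        show ?thesis
          using trace_exp_variational[OF H \<tau> True]
          unfolding QKL_eq[OF assms(1,4) \<tau> True] rhs by simp
      \<comment> \<open>Outside the positive semidefinite matrices \<open>QKL\<close> is infinite,
        so the term is \<open>-\<infinity>\<close>.\<close>
      qed (simp add: QKL_def)
    qed
    \<comment> \<open>The bound is attained at a Hermitian matrix, so the supremum is a
      maximum.\<close>
    have "ereal (Re (mtrace (mat_exp ?H - \<rho>0))) = ?F \<rho>"
      unfolding QKL_eq[OF assms(1,4) \<rho>(1,2)] rhs \<rho>(3) ..
    also have "\<dots> \<le> (SUP \<rho> \<in> Herm N. ?F \<rho>)" by (rule SUP_upper[OF \<rho>(1)])
    finally show "ereal (Re (mtrace (mat_exp ?H - \<rho>0))) \<le> (SUP \<rho> \<in> Herm N. ?F \<rho>)" .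
  qed
  then show ?thesis by (simp add: herm_conjugate_def)
qed

end
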